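(* Let $C(0)=\mathbb{F}_8^{22}$ and, for $1\le s\le 22$, let $C(s)$ be the dual code of $\mathrm{Span}_{\mathbb{F}_8}\{\mathrm{ev}(M_1),\ldots,\mathrm{ev}(M_s)\}$, for the Klein quartic over $\mathbb{F}_8$ with the monomials $M_1,\ldots,M_{22}$ described in the context. Then for every $i\in\{1,\ldots,22\}$ every word $\vec c\in C(i-1)\setminus C(i)$ has Hamming weight at least $\mu_i$, where $$(\mu_1,\ldots,\mu_{22})=(1,2,2,3,4,4,3,6,6,6,8,8,9,11,12,12,14,15,15,17,18,21).$$
   Context: Let $I=\langle Y^3+X^3Y+X\rangle\subseteq\mathbb{F}_8[X,Y]$ and let $\{P_1,\ldots,P_{22}\}\subseteq\mathbb{F}_8^2$ be the set of the 22 affine $\mathbb{F}_8$-rational zeros of $Y^3+X^3Y+X$. For a polynomial $F$, $\mathrm{ev}(F)=(F(P_1),\ldots,F(P_{22}))\in\mathbb{F}_8^{22}$. The monomials are, in order, $M_1=1$, $M_2=X$, $M_3=Y$, $M_4=X^2$, $M_5=XY$, $M_6=X^3$, $M_7=Y^2$, $M_8=X^2Y$, $M_9=X^4$, $M_{10}=XY^2$, $M_{11}=X^3Y$, $M_{12}=X^5$, $M_{13}=X^2Y^2$, $M_{14}=X^4Y$, $M_{15}=X^6$, $M_{16}=X^3Y^2$, $M_{17}=X^5Y$, $M_{18}=X^7$, $M_{19}=X^4Y^2$, $M_{20}=X^6Y$, $M_{21}=X^5Y^2$, $M_{22}=X^6Y^2$. The vectors $\mathrm{ev}(M_1),\ldots,\mathrm{ev}(M_{22})$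 form a basis of $\mathbb{F}_8^{22}$. Duals are taken with respect to the standard bilinear form. *)

theory Defs
  imports "HOL-Analysis.Analysis" "HOL-Computational_Algebra.Polynomial"
begin

text \<open>
  \<open>F[X,Y]\<close> is represented by \<open>F poly poly\<close>, read as \<open>F[X][Y]\<close>: the outer indeterminate is \<open>Y\<close>.
\<close>

definition polyX :: "'a::field poly poly" where
  "polyX = [:[:0, 1:]:]"

definition polyY :: "'a::field poly poly" where
  "polyY = [:0, 1:]"

definition eval2 :: "'a::field poly poly \<Rightarrow> 'a \<times> 'a \<Rightarrow> 'a" where
  "eval2 F p = poly (poly F [:snd p:]) (fst p)"

definition klein :: "'a::field poly poly" where
  "klein = polyY ^ 3 + polyX ^ 3 * polyY + polyX"

definition klein_points :: "('a::field \<times> 'a) set" where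
  "klein_points = {p. eval2 klein p = 0}"

definition monomials :: "'a::field poly poly list" where
  "monomials =
    [1,
     polyX,
     polyY,
     polyX ^ 2,
     polyX * polyY,
     polyX ^ 3,
     polyY ^ 2,
     polyX ^ 2 * polyY,
     polyX ^ 4,
     polyX * polyY ^ 2,
     polyX ^ 3 * polyY,
     polyX ^ 5,
     polyX ^ 2 * polyY ^ 2,
     polyX ^ 4 * polyY,
     polyX ^ 6,
     polyX ^ 3 * polyY ^ 2,
     polyX ^ 5 * polyY,
     polyX ^ 7,
     polyX ^ 4 * polyY ^ 2,
     polyX ^ 6 * polyY,
     polyX ^ 5 * polyY ^ 2,
     polyX ^ 6 * polyY ^ 2]"

text \<open>
  \<open>M i\<close> and \<open>\<mu> i\<close> are indexed from 1 and are meaningful only for \<open>1 \<le> i \<le> 22\<close>.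
\<close>

definition M :: "nat \<Rightarrow> 'a::field poly poly" where
  "M i = monomials ! (i - 1)"

definition \<mu> :: "nat \<Rightarrow> nat" where
  "\<mu> i = [1, 2, 2, 3, 4, 4, 3, 6, 6, 6, 8, 8, 9, 11, 12, 12, 14, 15, 15, 17, 18, 21] ! (i - 1)"

definition ev :: "('n::finite \<Rightarrow> 'a \<times> 'a) \<Rightarrow> 'a::field poly poly \<Rightarrow> 'a ^ 'n" where
  "ev P F = (\<chi> j. eval2 F (P j))"

definition dual_code :: "('a::field ^ 'n::finite) set \<Rightarrow> ('a ^ 'n) set" where
  "dual_code D = {c. \<forall>d\<in>D. (\<Sum>j\<in>UNIV. c $ j * d $ j) = 0}"

definition hamming_weight :: "'a::field ^ 'n::finite \<Rightarrow> nat" where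
  "hamming_weight c = card {j. c $ j \<noteq> 0}"

definition C :: "('n::finite \<Rightarrow> 'a \<times> 'a) \<Rightarrow> nat \<Rightarrow> ('a::field ^ 'n) set" where
  "C P s = (if s = 0 then UNIV else dual_code (vec.span {ev P (M i) | i. i \<in> {1..s}}))"

end

theory Submission imports Defs begin

text \<open>
  Write \<open>\<langle>F\<rangle> = \<Sum>j. c\<^sub>j F(P\<^sub>j)\<close>. The assumption on \<open>c\<close> says that \<open>\<langle>M\<^sub>j\<rangle> = 0\<close> for
  \<open>j < i\<close> and \<open>\<langle>M\<^sub>i\<rangle> \<noteq> 0\<close>. If monomials \<open>F\<^sub>1, \<dots>, F\<^sub>k\<close> and \<open>G\<^sub>1, \<dots>, G\<^sub>k\<close> make the matrix
  \<open>\<langle>F\<^sub>a G\<^sub>b\<rangle>\<close> triangular with nonzero diagonal, then this matrix has rank \<open>k\<close>; since it factors through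
  the diagonal matrix of \<open>c\<close>, the weight of \<open>c\<close> is at least \<open>k\<close>. Each \<open>\<langle>F\<^sub>a G\<^sub>b\<rangle>\<close> is a sum of
  values \<open>\<langle>M\<^sub>j\<rangle>\<close>, by reduction modulo the curve equation and the field equation. Such monomials
  exist with \<open>k = \<mu>\<^sub>i\<close> for every \<open>i\<close>, except that for \<open>i \<in> {9, 12, 15}\<close> one chooses them
  according to whether \<open>\<langle>M\<^bsub>i+1\<^esub>\<rangle>\<close> vanishes. They are not restricted to the \<open>M\<^sub>j\<close>: \<open>Y\<close>-degrees
  up to \<open>6\<close> occur.
\<close>

section \<open>Arithmetic on the curve\<close>

text \<open>Translation by 1 permutes the field, so comparing sums gives 8 = 0. As 8 is the cube of
  2, also 2 = 0.\<close>

lemma card_8_char_2: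
  fixes x :: "'a::field"
  assumes "CARD('a) = 8"
  shows "x + x = 0"
proof -
  have "bij (\<lambda>y::'a. y + 1)"
    by (rule bij_betwI[where g = "\<lambda>y. y - 1"]) auto
  then have "(\<Sum>y::'a\<in>UNIV. y + 1) = (\<Sum>y::'a\<in>UNIV. y)"
    by (rule sum.reindex_bij_betw)
  then have "of_nat 8 = (0::'a)"
    by (simp add: sum.distrib assms)
  moreover have "of_nat 8 = (2::'a) ^ 3"
    by simp
  ultimately have "(2::'a) = 0"
    by (metis power_not_zero)
  then show ?thesis
    by (metis mult_2 mult_zero_left)
qed

text \<open>Multiplication by \<open>x\<close> permutes the seven nonzero elements; comparing their
  products cancels a nonzero factor.\<close>

lemma card_8_power_7:
  fixes x :: "'a::field"
  assumes "CARD('a) = 8" "x \<noteq> 0"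
  shows "x ^ 7 = 1"
proof -
  have fin: "finite (UNIV :: 'a set)"
    using assms(1) by (intro card_ge_0_finite) simp
  have "bij_betw (\<lambda>y. x * y) (- {0}) (- {0})"
    using assms(2) by (intro bij_betwI[where g = "\<lambda>y. y / x"]) auto
  then have "(\<Prod>y\<in>-{0}. x * y) = \<Prod>(- {0})"
    by (rule prod.reindex_bij_betw)
  moreover have "card (- {0::'a}) = 7"
    using fin assms(1) by (simp add: Compl_eq_Diff_UNIV)
  moreover have "\<Prod>(- {0::'a}) \<noteq> 0"
    using fin by (simp add: finite_subset[OF subset_UNIV])
  ultimately show ?thesis
    by (simp add: prod.distrib)
qed

text \<open>
  A set of exponent pairs stands for the sum of its monomials, so that addition in
  characteristic \<open>2\<close> is symmetric difference. The second case uses \<open>X\<^sup>8 = X\<close>, and \<open>X\<^sup>7 Y = Y\<close>, which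
  holds on the curve because \<open>X = 0\<close> forces \<open>Y = 0\<close>.
\<close>

fun klein_reduce :: "nat \<Rightarrow> nat \<Rightarrow> (nat \<times> nat) set" where
  "klein_reduce a b =
    (if 3 \<le> b then
       let A = klein_reduce (a + 3) (b - 2); B = klein_reduce (a + 1) (b - 3)
       in (A - B) \<union> (B - A)
     else if 8 \<le> a \<or> 7 \<le> a \<and> 1 \<le> b then klein_reduce (a - 7) b
     else {(a, b)})"

declare klein_reduce.simps [simp del]

lemma finite_klein_reduce: "finite (klein_reduce a b)"
proof (induction a b rule: klein_reduce.induct)
  case (1 a b)
  then show ?case
    by (subst klein_reduce.simps) (auto simp: Let_def)
qed

text \<open>The right-hand side counts \<open>A \<inter> B\<close> twice, which contributes
  zero.\<close>

lemma sum_sym_diff_char_2: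
  fixes f :: "'b \<Rightarrow> 'a::ab_group_add"
  assumes "finite A" "finite B" and char2: "\<And>x::'a. x + x = 0"
  shows "sum f ((A - B) \<union> (B - A)) = sum f A + sum f B"
proof -
  have "sum f A = sum f (A - B) + sum f (A \<inter> B)" "sum f B = sum f (B - A) + sum f (A \<inter> B)"
    using sum.Int_Diff[OF assms(1), of f B] sum.Int_Diff[OF assms(2), of f A]
    by (simp_all add: Int_commute add.commute)
  then have "sum f A + sum f B = sum f (A - B) + sum f (B - A) + (sum f (A \<inter> B) + sum f (A \<inter> B))"
    by (simp add: algebra_simps)
  moreover have "sum f ((A - B) \<union> (B - A)) = sum f (A - B) + sum f (B - A)"
    using assms(1,2) by (intro sum.union_disjoint) auto
  ultimately show ?thesis
    by (simp add: char2)
qed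

lemma klein_pointD:
  fixes p :: "'a::field \<times> 'a"
  assumes "CARD('a) = 8" "p \<in> klein_points"
  shows "snd p ^ 3 = fst p ^ 3 * snd p + fst p"
proof -
  have "snd p ^ 3 + (fst p ^ 3 * snd p + fst p) = 0"
    using assms(2)
    by (simp add: klein_points_def klein_def eval2_def polyX_def polyY_def algebra_simps)
  then show ?thesis
    using card_8_char_2[OF assms(1)] by (metis add_right_cancel)
qed

lemma klein_reduce_eval:
  fixes p :: "'a::field \<times> 'a"
  assumes card: "CARD('a) = 8" and p: "p \<in> klein_points"
  shows "fst p ^ a * snd p ^ b = (\<Sum>(u, v)\<in>klein_reduce a b. fst p ^ u * snd p ^ v)"
proof (induction a b rule: klein_reduce.induct)
  case (1 a b)
  let ?x = "fst p" and ?y = "snd p"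
  consider "3 \<le> b" | "b < 3" "8 \<le> a \<or> 7 \<le> a \<and> 1 \<le> b" | "b < 3" "\<not> (8 \<le> a \<or> 7 \<le> a \<and> 1 \<le> b)"
    by linarith
  then show ?case
  proof cases
    case 1
    let ?A = "klein_reduce (a + 3) (b - 2)" and ?B = "klein_reduce (a + 1) (b - 3)"
    obtain k where k: "b = k + 3"
      using 1 by (metis add.commute le_Suc_ex)
    have "?x ^ a * ?y ^ b = ?x ^ a * ?y ^ k * ?y ^ 3"
      by (simp add: k power_add)
    also have "\<dots> = ?x ^ (a + 3) * ?y ^ (b - 2) + ?x ^ (a + 1) * ?y ^ (b - 3)"
      by (simp add: klein_pointD[OF card p] k power_add algebra_simps)
    also have "\<dots> = (\<Sum>(u, v)\<in>?A. ?x ^ u * ?y ^ v) + (\<Sum>(u, v)\<in>?B. ?x ^ u * ?y ^ v)"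
      using "1.IH"(1,2) 1 by simp
    also have "\<dots> = (\<Sum>(u, v)\<in>(?A - ?B) \<union> (?B - ?A). ?x ^ u * ?y ^ v)"
      by (rule sum_sym_diff_char_2[symmetric])
        (simp_all add: finite_klein_reduce card_8_char_2[OF card])
    finally show ?thesis
      using 1 by (subst klein_reduce.simps) (simp add: Let_def)
  next
    case 2
    \<comment> \<open>At the origin both sides vanish: lowering \<open>a\<close> by 7 leaves a
      positive exponent on \<open>?x\<close> or on \<open>?y\<close>, since \<open>8 \<le> a\<close>
      or \<open>1 \<le> b\<close>.\<close>
    have "?x ^ a * ?y ^ b = ?x ^ (a - 7) * ?y ^ b"
    proof (cases "?x = 0")
      case True
      then have "?y = 0"
        using klein_pointD[OF card p] by simp
      with True 2 show ?thesis
        by (auto simp: power_0_left)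
    next
      case False
      have "7 \<le> a"
        using 2 by linarith
      then have "?x ^ a = ?x ^ (a - 7) * ?x ^ 7"
        by (simp flip: power_add)
      with card_8_power_7[OF card False] show ?thesis
        by simp
    qed
    with "1.IH"(3) 2 show ?thesis
      by (subst klein_reduce.simps) simp
  next
    case 3
    then show ?thesis
      by (subst klein_reduce.simps) auto
  qed
qed

section \<open>Triangular certificates\<close>

text \<open>The functional \<langle>F\<rangle> at the monomial F with exponent pair
  \<open>e\<close>.\<close>

definition moment :: "('n::finite \<Rightarrow> 'a \<times> 'a) \<Rightarrow> 'a::field ^ 'n \<Rightarrow> nat \<times> nat \<Rightarrow> 'a" where
  "moment P c e = (\<Sum>j\<in>UNIV. c $ j * (fst (P j) ^ fst e * snd (P j) ^ snd e))"

lemma moment_reduce: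
  fixes P :: "'n::finite \<Rightarrow> 'a::field \<times> 'a"
  assumes "CARD('a) = 8" "\<And>j. P j \<in> klein_points"
  shows "moment P c e = (\<Sum>d\<in>klein_reduce (fst e) (snd e). moment P c d)"
proof -
  have "moment P c e = (\<Sum>j\<in>UNIV. \<Sum>d\<in>klein_reduce (fst e) (snd e).
      c $ j * (fst (P j) ^ fst d * snd (P j) ^ snd d))"
    unfolding moment_def klein_reduce_eval[OF assms, where a = "fst e" and b = "snd e"]
    by (simp add: sum_distrib_left case_prod_unfold)
  then show ?thesis
    unfolding moment_def by (subst sum.swap) simp
qed

text \<open>Each pair supplies a row and a column, and the entries below the diagonal vanish. The
  two predicates are parameters so that a computable test on exponents can be transferred to moments
  by monotonicity.\<close>

fun triangular :: "('r \<Rightarrow> 's \<Rightarrow> bool) \<Rightarrow> ('r \<Rightarrow> 's \<Rightarrow> bool) \<Rightarrow> ('r \<times> 's) list \<Rightarrow> bool" where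
  "triangular zero nonzero [] \<longleftrightarrow> True"
| "triangular zero nonzero ((r, s) # ps) \<longleftrightarrow>
     nonzero r s \<and> list_all (\<lambda>(r', _). zero r' s) ps \<and> triangular zero nonzero ps"

lemma triangular_mono:
  assumes "triangular Z N ps" "\<And>r s. Z r s \<Longrightarrow> Z' r s" "\<And>r s. N r s \<Longrightarrow> N' r s"
  shows "triangular Z' N' ps"
  using assms(1)
proof (induction ps)
  case (Cons p ps)
  then show ?case
    by (cases p) (auto simp: list_all_iff intro: assms(2,3))
qed simp

text \<open>Scale the row functions by \<open>c\<close>. Pairing with the column function of the
  first pair kills all later scaled rows but not the first, so by induction the scaled rows are
  distinct and independent.\<close>

lemma triangular_length_le_hamming_weight:
  fixes c :: "'a::field ^ 'n::finite" and f :: "'r \<Rightarrow> 'n \<Rightarrow> 'a" and g :: "'s \<Rightarrow> 'n \<Rightarrow> 'a"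
  defines "B \<equiv> \<lambda>r s. \<Sum>j\<in>UNIV. c $ j * (f r j * g s j)"
  assumes "triangular (\<lambda>r s. B r s = 0) (\<lambda>r s. B r s \<noteq> 0) ps"
  shows "length ps \<le> hamming_weight c"
proof -
  define v where "v r = (\<chi> j. c $ j * f r j)" for r
  define V where "V ps = v ` fst ` set ps" for ps :: "('r \<times> 's) list"
  have V: "vec.independent (V ps) \<and> card (V ps) = length ps"
    using assms(2)
  proof (induction ps)
    case Nil
    show ?case
      by (simp add: V_def vec.independent_empty)
  next
    case (Cons p ps)
    obtain r s where p: "p = (r, s)"
      by force
    have "(\<Sum>j\<in>UNIV. w $ j * g s j) = 0" if "w \<in> vec.span (V ps)" for w
      using that
    proof (induction rule: vec.span_induct_alt)
      case (step k x y)
      have "(\<Sum>j\<in>UNIV. x $ j * g s j) = 0"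
        using step(1) Cons.prems
        by (auto simp: V_def v_def p B_def list_all_iff mult.assoc)
      with step(2) show ?case
        by (simp add: distrib_right sum.distrib mult.assoc flip: sum_distrib_left)
    qed simp
    moreover have "(\<Sum>j\<in>UNIV. v r $ j * g s j) \<noteq> 0"
      using Cons.prems by (simp add: v_def p B_def mult.assoc)
    ultimately have "v r \<notin> vec.span (V ps)"
      by blast
    moreover from this have "v r \<notin> V ps"
      using vec.span_base by blast
    moreover have "V (p # ps) = insert (v r) (V ps)" "finite (V ps)"
      by (simp_all add: V_def p)
    ultimately show ?case
      using Cons by (simp add: p vec.independent_insert)
  qed
  \<comment> \<open>All these vectors lie in the coordinate subspace on the support of
    \<open>c\<close>, whose dimension is the weight.\<close>
  have "V ps \<subseteq> {x. \<forall>j. j \<notin> {j. c $ j \<noteq> 0} \<longrightarrow> x $ j = 0}"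
    by (auto simp: V_def v_def)
  from vec.independent_card_le_dim[OF this V[THEN conjunct1]] show ?thesis
    unfolding dim_substandard_cart hamming_weight_def V[THEN conjunct2] .
qed

text \<open>\<open>zs\<close> holds exponents with vanishing moment, \<open>ns\<close> exponents
  with nonvanishing moment. A diagonal entry must leave a single term from \<open>ns\<close>,
  because several nonzero terms could cancel.\<close>

definition certifies ::
    "(nat \<times> nat) list \<Rightarrow> (nat \<times> nat) list \<Rightarrow> ((nat \<times> nat) \<times> (nat \<times> nat)) list \<Rightarrow> bool" where
  "certifies zs ns =
    (let R = \<lambda>e d. klein_reduce (fst e + fst d) (snd e + snd d) - set zs
     in triangular (\<lambda>e d. R e d = {}) (\<lambda>e d. \<exists>n\<in>set ns. R e d = {n}))"

lemma certifies_length_le_hamming_weight: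
  fixes P :: "'n::finite \<Rightarrow> 'a::field \<times> 'a"
  assumes card: "CARD('a) = 8" and P: "\<And>j. P j \<in> klein_points"
    and zs: "\<And>e. e \<in> set zs \<Longrightarrow> moment P c e = 0"
    and ns: "\<And>e. e \<in> set ns \<Longrightarrow> moment P c e \<noteq> 0"
    and cert: "certifies zs ns ps"
  shows "length ps \<le> hamming_weight c"
proof (rule triangular_length_le_hamming_weight)
  let ?x = "\<lambda>j. fst (P j)" and ?y = "\<lambda>j. snd (P j)"
  let ?f = "\<lambda>e j. ?x j ^ fst e * ?y j ^ snd e"
  let ?R = "\<lambda>e d. klein_reduce (fst e + fst d) (snd e + snd d)"
  have B: "(\<Sum>j\<in>UNIV. c $ j * (?f e j * ?f d j)) = (\<Sum>n\<in>?R e d - set zs. moment P c n)" for e d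
  proof -
    have "(\<Sum>j\<in>UNIV. c $ j * (?f e j * ?f d j)) = moment P c (fst e + fst d, snd e + snd d)"
      by (simp add: moment_def power_add algebra_simps)
    also have "\<dots> = (\<Sum>n\<in>?R e d. moment P c n)"
      using moment_reduce[where P = P and e = "(fst e + fst d, snd e + snd d)", OF card P]
      by (simp only: fst_conv snd_conv)
    also have "\<dots> = (\<Sum>n\<in>?R e d - set zs. moment P c n)"
      by (rule sum.mono_neutral_right) (auto simp: finite_klein_reduce zs)
    finally show ?thesis .
  qed
  show "triangular (\<lambda>e d. (\<Sum>j\<in>UNIV. c $ j * (?f e j * ?f d j)) = 0)
      (\<lambda>e d. (\<Sum>j\<in>UNIV. c $ j * (?f e j * ?f d j)) \<noteq> 0) ps"
    using cert unfolding certifies_def Let_def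
  proof (rule triangular_mono)
    fix e d
    assume "?R e d - set zs = {}"
    then show "(\<Sum>j\<in>UNIV. c $ j * (?f e j * ?f d j)) = 0"
      unfolding B by (simp only: sum.empty)
  next
    fix e d
    assume "\<exists>n\<in>set ns. ?R e d - set zs = {n}"
    then obtain n where "n \<in> set ns" "?R e d - set zs = {n}"
      by blast
    then show "(\<Sum>j\<in>UNIV. c $ j * (?f e j * ?f d j)) \<noteq> 0"
      unfolding B using ns[of n] by (simp only: sum.insert sum.empty) simp
  qed
qed

section \<open>The Klein quartic codes\<close>

text \<open>Entry \<open>i - 1\<close> belongs to \<open>M i\<close>. These 22 pairs are exactly the
  normal forms of \<open>klein_reduce\<close>: \<open>Y\<close>-degree at most 2, and
  \<open>X\<close>-degree at most 7, or at most 6 when \<open>Y\<close> occurs.\<close>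

definition exponents :: "(nat \<times> nat) list" where
  "exponents =
    [(0,0), (1,0), (0,1), (2,0), (1,1), (3,0), (0,2), (2,1), (4,0), (1,2), (3,1),
     (5,0), (2,2), (4,1), (6,0), (3,2), (5,1), (7,0), (4,2), (6,1), (5,2), (6,2)]"

lemma eval2_M:
  fixes p :: "'a::field \<times> 'a"
  assumes "i \<in> {1..22}"
  shows "eval2 (M i) p = fst p ^ fst (exponents ! (i - 1)) * snd p ^ snd (exponents ! (i - 1))"
proof -
  have monomials: "monomials = map (\<lambda>(a, b). polyX ^ a * polyY ^ b :: 'a poly poly) exponents"
    by (simp add: monomials_def exponents_def)
  have "i - 1 < length exponents"
    using assms by (auto simp: exponents_def)
  then have "M i = (\<lambda>(a, b). polyX ^ a * polyY ^ b :: 'a poly poly) (exponents ! (i - 1))"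
    unfolding M_def monomials by (rule nth_map)
  then show ?thesis
    by (simp add: eval2_def polyX_def polyY_def case_prod_unfold)
qed

lemma moment_exponents:
  assumes "i \<in> {1..22}"
  shows "moment P c (exponents ! (i - 1)) = (\<Sum>j\<in>UNIV. c $ j * ev P (M i) $ j)"
  by (simp add: moment_def ev_def eval2_M[OF assms])

text \<open>Orthogonality to the generators extends to their span by linearity. For
  \<open>s = 0\<close> the condition is vacuous, matching \<open>C P 0 = UNIV\<close>.\<close>

lemma C_iff_moments:
  assumes "s \<le> 22"
  shows "c \<in> C P s \<longleftrightarrow> (\<forall>i\<in>{1..s}. moment P c (exponents ! (i - 1)) = 0)"
proof (cases "s = 0")
  case False
  let ?G = "{ev P (M i) |i. i \<in> {1..s}}"
  have "(\<Sum>j\<in>UNIV. c $ j * d $ j) = 0"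
    if "\<And>g. g \<in> ?G \<Longrightarrow> (\<Sum>j\<in>UNIV. c $ j * g $ j) = 0" "d \<in> vec.span ?G" for d
    using that(2)
  proof (induction rule: vec.span_induct_alt)
    case (step k x y)
    have "(\<Sum>j\<in>UNIV. c $ j * (k *s x + y) $ j)
        = k * (\<Sum>j\<in>UNIV. c $ j * x $ j) + (\<Sum>j\<in>UNIV. c $ j * y $ j)"
      by (simp add: algebra_simps sum.distrib sum_distrib_left)
    then show ?case
      using that(1)[OF step(1)] step(2) by simp
  qed simp
  then have "c \<in> C P s \<longleftrightarrow> (\<forall>g\<in>?G. (\<Sum>j\<in>UNIV. c $ j * g $ j) = 0)"
    using False by (auto simp only: C_def dual_code_def if_False mem_Collect_eq intro: vec.span_base)
  also have "\<dots> \<longleftrightarrow> (\<forall>i\<in>{1..s}. (\<Sum>j\<in>UNIV. c $ j * ev P (M i) $ j) = 0)"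
    by blast
  also have "\<dots> \<longleftrightarrow> (\<forall>i\<in>{1..s}. moment P c (exponents ! (i - 1)) = 0)"
    using assms by (intro ball_cong refl) (subst moment_exponents, auto)
  finally show ?thesis .
qed (simp add: C_def)

text \<open>
  Found by a computer search. Entry \<open>i - 1\<close> lists the exponents of the pairs \<open>(F\<^sub>a, G\<^sub>a)\<close> for
  \<open>\<mu>\<^sub>i\<close>; for \<open>i \<in> {9, 12, 15}\<close> it applies when \<open>\<langle>M\<^bsub>i+1\<^esub>\<rangle> = 0\<close>, and \<open>split_certificate i\<close>
  (meaningful for these \<open>i\<close> only) applies otherwise.
\<close>

definition certificates :: "((nat \<times> nat) \<times> (nat \<times> nat)) list list" where
  "certificates =
    [[((0,0),(0,0))],
     [((1,0),(0,0)),((0,0),(1,0))],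
     [((6,1),(1,0)),((0,0),(0,1))],
     [((2,0),(0,0)),((1,0),(1,0)),((0,0),(2,0))],
     [((1,1),(0,0)),((0,1),(1,0)),((1,0),(0,1)),((0,0),(1,1))],
     [((3,0),(0,0)),((2,0),(1,0)),((1,0),(2,0)),((0,0),(3,0))],
     [((0,6),(1,0)),((0,1),(0,1)),((0,0),(0,2))],
     [((2,1),(0,0)),((1,1),(1,0)),((2,0),(0,1)),((0,1),(2,0)),((1,0),(1,1)),((0,0),(2,1))],
     [((4,0),(0,0)),((3,0),(1,0)),((1,0),(1,6)),((0,0),(2,6)),((1,1),(1,5)),((0,1),(2,5))],
     [((1,2),(0,0)),((1,0),(1,6)),((0,0),(2,6)),((1,1),(1,5)),((0,2),(1,0)),((0,1),(1,1))],
     [((0,3),(0,0)),((2,1),(1,0)),((0,2),(0,1)),((1,1),(2,0)),((2,0),(1,1)),((0,1),(0,2)),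
      ((1,0),(2,1)),((0,0),(0,3))],
     [((1,3),(0,2)),((2,4),(1,2)),((2,5),(1,1)),((1,5),(2,1)),((2,6),(1,0)),((1,6),(2,0)),
      ((0,6),(3,0)),((1,0),(4,0))],
     [((2,2),(0,0)),((1,2),(1,0)),((2,1),(0,1)),((2,0),(1,6)),((1,0),(2,6)),((0,0),(1,5)),
      ((1,1),(2,5)),((0,2),(2,0)),((0,1),(2,1))],
     [((0,4),(1,6)),((1,3),(0,0)),((0,3),(1,0)),((1,2),(0,1)),((2,1),(2,0)),((0,2),(1,1)),
      ((1,1),(0,2)),((2,0),(2,1)),((0,1),(1,2)),((1,0),(0,3)),((0,0),(1,3))],
     [((2,3),(0,2)),((2,4),(0,1)),((1,4),(1,1)),((2,5),(0,0)),((1,5),(1,0)),((2,6),(2,0)),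
      ((3,0),(3,0)),((2,0),(2,6)),((1,0),(1,5)),((0,0),(2,5)),((1,1),(1,4)),((0,1),(2,4))],
     [((0,4),(0,0)),((2,2),(1,0)),((0,3),(0,1)),((1,2),(2,0)),((2,1),(1,1)),((3,0),(1,6)),
      ((2,0),(2,6)),((1,0),(1,5)),((0,0),(2,5)),((1,1),(1,4)),((0,2),(0,2)),((0,1),(0,3))],
     [((1,4),(1,6)),((2,3),(0,0)),((0,4),(2,6)),((1,3),(1,0)),((2,2),(0,1)),((0,3),(2,0)),
      ((1,2),(1,1)),((2,1),(0,2)),((0,2),(2,1)),((1,1),(1,2)),((2,0),(0,3)),((0,1),(2,2)),
      ((1,0),(1,3)),((0,0),(2,3))],
     [((3,0),(4,0)),((3,2),(3,1)),((4,0),(3,0)),((4,2),(2,1)),((5,0),(2,0)),((5,1),(1,2)),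
      ((5,2),(1,1)),((6,0),(1,0)),((6,1),(0,2)),((0,6),(0,1)),((7,0),(0,0)),((0,0),(7,0)),
      ((2,0),(5,0)),((0,1),(0,6)),((1,0),(6,0))],
     [((0,4),(1,0)),((1,3),(0,1)),((2,2),(2,0)),((0,3),(1,1)),((1,2),(3,0)),((4,0),(0,2)),
      ((2,1),(2,1)),((0,2),(4,0)),((3,0),(1,2)),((1,1),(0,3)),((2,0),(2,2)),((0,6),(5,0)),
      ((0,1),(1,3)),((1,0),(0,4)),((0,0),(1,4))],
     [((6,0),(1,5)),((2,4),(1,6)),((0,5),(0,0)),((1,4),(2,6)),((2,3),(1,0)),((0,4),(0,1)),
      ((1,3),(2,0)),((2,2),(1,1)),((0,3),(0,2)),((1,2),(2,1)),((2,1),(1,2)),((0,2),(0,3)),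
      ((1,1),(2,2)),((2,0),(1,3)),((0,1),(0,4)),((1,0),(2,3)),((0,0),(0,5))],
     [((0,1),(2,3)),((1,2),(3,3)),((1,5),(3,0)),((0,5),(4,0)),((5,0),(0,2)),((4,0),(1,2)),
      ((2,3),(0,1)),((0,2),(5,0)),((3,0),(2,2)),((1,3),(1,1)),((2,0),(0,4)),((0,6),(6,0)),
      ((2,4),(0,0)),((0,3),(2,1)),((1,0),(1,4)),((1,4),(1,0)),((2,1),(0,3)),((0,0),(2,4))],
     [((2,4),(1,0)),((0,3),(0,3)),((1,0),(2,4)),((2,3),(1,1)),((0,2),(6,0)),((3,0),(0,4)),
      ((1,3),(2,1)),((0,6),(0,0)),((2,0),(1,4)),((2,2),(4,0)),((5,0),(1,2)),((0,1),(0,5)),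
      ((1,1),(2,3)),((0,4),(3,0)),((6,0),(0,2)),((1,2),(4,3)),((0,5),(0,1)),((4,0),(2,2)),
      ((1,4),(2,0)),((2,1),(1,3)),((0,0),(0,6))]]"

definition split_certificate :: "nat \<Rightarrow> ((nat \<times> nat) \<times> (nat \<times> nat)) list" where
  "split_certificate i =
    (if i = 9 then
     [((1,2),(0,0)),((0,2),(1,0)),((1,1),(0,1)),((2,0),(2,0)),((0,1),(1,1)),((1,0),(0,2))]
     else if i = 12 then
     [((2,2),(0,0)),((1,2),(1,0)),((2,1),(0,1)),((0,2),(2,0)),((1,1),(1,1)),((2,0),(0,2)),
      ((0,1),(2,1)),((1,0),(1,2))]
     else
     [((2,3),(1,6)),((0,4),(0,0)),((2,2),(1,0)),((0,3),(0,1)),((1,2),(2,0)),((2,1),(1,1)),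
      ((0,2),(0,2)),((1,1),(2,1)),((2,0),(1,2)),((0,1),(0,3)),((1,0),(2,2)),((0,0),(0,4))])"

text \<open>A finite computation on exponents. By the index shift, \<open>exponents ! i\<close>
  belongs to \<open>M (i + 1)\<close>; it joins the vanishing list in one branch and the
  nonvanishing list in the other.\<close>

lemma certificates_valid:
  "\<forall>i\<in>set [1..<23]. \<mu> i \<le> length (certificates ! (i - 1)) \<and>
    (if i \<in> {9, 12, 15} then
       certifies (take (i - 1) exponents @ [exponents ! i]) [exponents ! (i - 1)]
         (certificates ! (i - 1)) \<and>
       \<mu> i \<le> length (split_certificate i) \<and>
       certifies (take (i - 1) exponents) [exponents ! (i - 1), exponents ! i] (split_certificate i)
     else certifies (take (i - 1) exponents) [exponents ! (i - 1)] (certificates ! (i - 1)))"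
  by code_simp

theorem mainTheorem6:
  fixes P :: "22 \<Rightarrow> 'a::field \<times> 'a"
  assumes "CARD('a) = 8"
    and "bij_betw P UNIV klein_points"
  shows "\<forall>i\<in>{1..22}. \<forall>c \<in> C P (i - 1) - C P i. \<mu> i \<le> hamming_weight c"
proof (intro ballI)
  fix i c
  assume i: "i \<in> {1..22}" and c: "c \<in> C P (i - 1) - C P i"
  have "P j \<in> klein_points" for j
    using assms(2) by (auto simp: bij_betw_def)
  note bound = certifies_length_le_hamming_weight[OF assms(1) this, where c = c]
  have before: "moment P c (exponents ! (k - 1)) = 0" if "k \<in> {1..i - 1}" for k
    using C_iff_moments[of "i - 1" c P] c i that by auto
  have zero: "moment P c e = 0" if "e \<in> set (take (i - 1) exponents)" for e
    using before[of "Suc _"] that by (auto simp: in_set_conv_nth)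
  \<comment> \<open>The earlier moments vanish, so a zero here would put \<open>c\<close> into
    \<open>C P i\<close>.\<close>
  have nonzero: "moment P c (exponents ! (i - 1)) \<noteq> 0"
  proof
    assume "moment P c (exponents ! (i - 1)) = 0"
    then have "moment P c (exponents ! (k - 1)) = 0" if "k \<in> {1..i}" for k
      using before[of k] that by (cases "k = i") auto
    then have "c \<in> C P i"
      using i by (simp add: C_iff_moments)
    with c show False
      by simp
  qed
  have valid: "\<mu> i \<le> length (certificates ! (i - 1))"
    "i \<in> {9, 12, 15} \<Longrightarrow>
      certifies (take (i - 1) exponents @ [exponents ! i]) [exponents ! (i - 1)]
        (certificates ! (i - 1)) \<and>
      \<mu> i \<le> length (split_certificate i) \<and>
      certifies (take (i - 1) exponents) [exponents ! (i - 1), exponents ! i] (split_certificate i)"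
    "i \<notin> {9, 12, 15} \<Longrightarrow>
      certifies (take (i - 1) exponents) [exponents ! (i - 1)] (certificates ! (i - 1))"
    using bspec[OF certificates_valid, of i] i by (auto split: if_splits)
  \<comment> \<open>For the three exceptional \<open>i\<close>, the value at
    \<open>M (i + 1)\<close>, on which the choice of \<open>c\<close> imposes no condition, selects
    the certificate.\<close>
  consider "i \<notin> {9, 12, 15}" | "i \<in> {9, 12, 15}" "moment P c (exponents ! i) = 0"
    | "i \<in> {9, 12, 15}" "moment P c (exponents ! i) \<noteq> 0"
    by blast
  then show "\<mu> i \<le> hamming_weight c"
  proof cases
    case 1
    have "length (certificates ! (i - 1)) \<le> hamming_weight c"
      using valid(3)[OF 1] by (rule bound[rotated 2]) (use zero nonzero in auto)
    with valid(1) show ?thesis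
      by linarith
  next
    case 2
    have "length (certificates ! (i - 1)) \<le> hamming_weight c"
      using valid(2)[OF 2(1), THEN conjunct1]
      by (rule bound[rotated 2]) (use zero nonzero 2(2) in auto)
    with valid(1) show ?thesis
      by linarith
  next
    case 3
    have "length (split_certificate i) \<le> hamming_weight c"
      using valid(2)[OF 3(1), THEN conjunct2, THEN conjunct2]
      by (rule bound[rotated 2]) (use zero nonzero 3(2) in auto)
    with valid(2)[OF 3(1)] show ?thesis
      by linarith
  qed
qed

end
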